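(* Let $1\leq p\leq q<\infty$ and let $\lambda,\alpha,\beta,\varphi,\psi$ be real numbers. Then the operator $\mathbf{H}_{\lambda,\alpha,\beta}$ is bounded from $l_{\varphi}^p$ to $L_{\psi}^q$ if and only if both $$\lambda\geq \alpha+\beta+1+\frac{\psi+1}{q}-\frac{\varphi+1}{p}\qquad\text{and}\qquad -q\beta<\psi+1<q(\lambda-\beta)$$ hold.
   Context: Let $\mathbb{R}_{+}=(0,+\infty)$ and $\mathbb{N}=\{1,2,3,\dots\}$. For real $\lambda,\alpha,\beta$ and a real sequence $a=\{a_m\}_{m=1}^{\infty}$, define $$\mathbf{H}_{\lambda,\alpha,\beta}a(x):=\sum_{m=1}^{\infty}\frac{m^{\alpha}x^{\beta}}{[\max\{m,x\}]^{\lambda}}a_m,\quad x\in\mathbb{R}_{+}.$$ For $1\le p<\infty$ and $\theta\in\mathbb{R}$, $l_\theta^p$ is the space of real sequences with $\|a\|_{p,\theta}=(\sum_{n=1}^\infty n^\theta|a_n|^p)^{1/p}<\infty$, and $L_\theta^p$ is the space of real-valued measurable functions $f$ on $\mathbb{R}_{+}$ with $\|f\|_{p,\theta}=(\int_{\mathbb{R}_{+}}|f(x)|^p x^\theta\,dx)^{1/p}<\infty$. The operator is bounded from a sequence space $X$ to a function space $Y$ if for every $a\in X$ the defining series converges for a.e. $x\in\mathbb{R}_{+}$ and there is a constant $C$ with $\|\mathbf{H}_{\lambda,\alpha,\beta}a\|_Y\le C\|a\|_X$ for all $a\in X$. *)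

theory Defs
  imports "HOL-Analysis.Analysis"
begin

text \<open>
  A real sequence indexed by 1, 2, 3, ... is modelled as a function \<open>nat \<Rightarrow> real\<close> whose value
  at 0 is never inspected: all series below run over \<open>Suc n\<close>. The half-line of positive reals
  carries the Lebesgue measure \<open>lebesgue_on {0<..}\<close>.
\<close>

definition seq_space :: "real \<Rightarrow> real \<Rightarrow> (nat \<Rightarrow> real) set" where
  "seq_space p \<theta> = {a. summable (\<lambda>n. real (Suc n) powr \<theta> * \<bar>a (Suc n)\<bar> powr p)}"

definition seq_norm :: "real \<Rightarrow> real \<Rightarrow> (nat \<Rightarrow> real) \<Rightarrow> real" where
  "seq_norm p \<theta> a = (\<Sum>n. real (Suc n) powr \<theta> * \<bar>a (Suc n)\<bar> powr p) powr (1 / p)"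

definition fun_space :: "real \<Rightarrow> real \<Rightarrow> (real \<Rightarrow> real) set" where
  "fun_space p \<theta> = {f. f \<in> borel_measurable (lebesgue_on {0<..}) \<and>
     integrable (lebesgue_on {0<..}) (\<lambda>x. \<bar>f x\<bar> powr p * x powr \<theta>)}"

definition fun_norm :: "real \<Rightarrow> real \<Rightarrow> (real \<Rightarrow> real) \<Rightarrow> real" where
  "fun_norm p \<theta> f = (LINT x|lebesgue_on {0<..}. \<bar>f x\<bar> powr p * x powr \<theta>) powr (1 / p)"

definition H_term :: "real \<Rightarrow> real \<Rightarrow> real \<Rightarrow> (nat \<Rightarrow> real) \<Rightarrow> real \<Rightarrow> nat \<Rightarrow> real" where
  "H_term lam \<alpha> \<beta> a x m = real m powr \<alpha> * x powr \<beta> / max (real m) x powr lam * a m"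

text \<open>Where the series diverges, \<open>H_op\<close> has an unspecified value; boundedness includes
  convergence almost everywhere, so these points do not matter.\<close>

definition H_op :: "real \<Rightarrow> real \<Rightarrow> real \<Rightarrow> (nat \<Rightarrow> real) \<Rightarrow> real \<Rightarrow> real" where
  "H_op lam \<alpha> \<beta> a x = (\<Sum>n. H_term lam \<alpha> \<beta> a x (Suc n))"

text \<open>The real-valued \<open>fun_norm\<close> is meaningful only on \<open>fun_space\<close> (a nonintegrable function
  has Bochner integral 0), so membership of the image in \<open>fun_space\<close> is required explicitly.\<close>

definition H_bounded ::
  "real \<Rightarrow> real \<Rightarrow> real \<Rightarrow> real \<Rightarrow> real \<Rightarrow> real \<Rightarrow> real \<Rightarrow> bool" where
  "H_bounded lam \<alpha> \<beta> p \<phi> q \<psi> \<longleftrightarrow>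
     (\<forall>a \<in> seq_space p \<phi>.
        AE x in lebesgue_on {0<..}. summable (\<lambda>n. H_term lam \<alpha> \<beta> a x (Suc n))) \<and>
     (\<exists>C. \<forall>a \<in> seq_space p \<phi>.
        H_op lam \<alpha> \<beta> a \<in> fun_space q \<psi> \<and>
        fun_norm q \<psi> (H_op lam \<alpha> \<beta> a) \<le> C * seq_norm p \<phi> a)"

end

theory Submission imports Defs begin

text \<open>
  Write \<open>m\<close> for the summation index and put \<open>2s = lam - \<beta> - (\<psi> + 1)/q\<close> and \<open>2t = \<beta> + (\<psi> + 1)/q\<close>.
  The two strict inequalities say that \<open>s\<close> and \<open>t\<close> are positive; the lower bound on \<open>lam\<close> says that
  the operator, with its weights, does not gain under dilation to large scales.

  Necessity is seen on two test sequences. The image of the first unit sequence is a pure power near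
  0 and another one near infinity, and it lies in the target space only if the strict inequalities
  hold (\<open>H_bounded_imp_endpoint_conditions\<close>). The indicator of \<open>[N, 2N)\<close>, for \<open>N\<close> tending to
  infinity, compares the growth of both sides (\<open>H_bounded_imp_scaling_condition\<close>).

  For sufficiency, \<open>\<alpha>\<close> can be increased until the lower bound on \<open>lam\<close> is attained, because
  \<open>m \<ge> 1\<close>. With \<open>b\<^sub>m\<close> denoting \<open>\<bar>a\<^sub>m\<bar>\<close> times \<open>m\<close> to the power \<open>\<phi>/p\<close>, the weighted image is then at most
  a series in \<open>b\<close> whose kernel is the square of \<open>k(m, x) = min ((m/x)\<^sup>s) ((x/m)\<^sup>t)\<close> times powers of \<open>m\<close>
  and \<open>x\<close> (\<open>H_term_le_hardy_kernel\<close>). The kernel \<open>k\<close> is at most 1, its integral against \<open>dx/x\<close> is the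
  constant \<open>1/s + 1/t\<close> (\<open>integral_hardy_kernel\<close>), and its sum against \<open>1/m\<close> is bounded
  uniformly in \<open>x\<close> (\<open>suminf_hardy_kernel_le\<close>). This is the situation of a Schur test: two applications of
  Jensen's inequality, for the exponents \<open>p\<close> and \<open>q/p\<close>, move the \<open>q\<close>-th power inside the
  series (\<open>hardy_kernel_power_mean\<close>), after which the integral can be taken term by term
  (\<open>conditions_imp_H_bounded\<close>). Using Jensen instead of Hoelder treats \<open>p = 1\<close> along with \<open>p > 1\<close>.
\<close>

section \<open>Power means of series\<close>

text \<open>
  Jensen's inequality for \<open>u \<mapsto> u\<^sup>p\<close> and nonnegative weights, in the form in which the total weight
  appears on the right. It comes from the tangent line inequality \<open>u \<le> 1 - 1/p + u\<^sup>p/p\<close>, applied to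
  \<open>u = c\<^sub>n/t\<close> and summed against \<open>w\<^sub>n\<close>. The tangent point \<open>t\<close> is the \<open>p\<close>-th power mean of \<open>c\<close>, for which
  the summed bound is exactly \<open>t\<close> times the total weight.
\<close>

lemma weighted_power_mean_suminf:
  fixes w c :: "nat \<Rightarrow> real" and p :: real
  assumes p: "1 \<le> p" and w: "\<And>n. 0 \<le> w n" and c: "\<And>n. 0 \<le> c n"
    and sw: "summable w" and sc: "summable (\<lambda>n. w n * c n powr p)"
  shows "summable (\<lambda>n. w n * c n)"
    and "(\<Sum>n. w n * c n) powr p \<le> (\<Sum>n. w n) powr (p - 1) * (\<Sum>n. w n * c n powr p)"
proof -
  \<comment> \<open>Young's inequality with second factor 1; the conjugate exponent exists only for \<open>p > 1\<close>.\<close>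
  have tangent: "u \<le> (1 - 1 / p) + u powr p / p" if "0 \<le> u" for u :: real
  proof (cases "p = 1")
    case True
    then show ?thesis using that by simp
  next
    case False
    then have p1: "1 < p" using p by simp
    have "u * 1 \<le> u powr p / p + 1 powr (p / (p - 1)) / (p / (p - 1))"
      by (rule Youngs_inequality) (use p1 that in \<open>auto simp: field_simps\<close>)
    then show ?thesis using p1 by (simp add: field_simps)
  qed
  have cb: "c n \<le> 1 + c n powr p" for n
  proof -
    have "c n \<le> (1 - 1 / p) + c n powr p / p" using tangent c by blast
    also have "\<dots> \<le> 1 + c n powr p"
    proof -
      have "c n powr p / p \<le> c n powr p" using p mult_right_mono[of 1 p "c n powr p"] by (simp add: field_simps)
      moreover have "0 \<le> 1 / p" using p by simp
      ultimately show ?thesis by linarith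
    qed
    finally show ?thesis .
  qed
  show swc: "summable (\<lambda>n. w n * c n)"
  proof (rule summable_comparison_test')
    show "summable (\<lambda>n. w n + w n * c n powr p)" using sw sc by (rule summable_add)
    show "norm (w n * c n) \<le> w n + w n * c n powr p" for n
      using mult_left_mono[OF cb w, of n n] w[of n] c[of n] by (simp add: algebra_simps)
  qed
  define W S where "W = (\<Sum>n. w n)" and "S = (\<Sum>n. w n * c n powr p)"
  have S0: "0 \<le> S" unfolding S_def using sc w by (intro suminf_nonneg) auto
  have W0: "0 \<le> W" unfolding W_def using sw w by (intro suminf_nonneg) auto
  show "(\<Sum>n. w n * c n) powr p \<le> (\<Sum>n. w n) powr (p - 1) * (\<Sum>n. w n * c n powr p)"
  proof (cases "S = 0")
    case True
    then have "w n * c n powr p = 0" for n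
      using suminf_eq_zero_iff[OF sc] w unfolding S_def by simp
    then have "(\<lambda>n. w n * c n) = (\<lambda>n. 0)" by (metis mult_eq_0_iff powr_eq_0_iff)
    then have "(\<Sum>n. w n * c n) = 0" by simp
    then show ?thesis using True by (simp add: S_def)
  next
    case False
    then have Sp: "0 < S" using S0 by simp
    have "W \<noteq> 0"
    proof
      assume "W = 0"
      then have "w n = 0" for n using suminf_eq_zero_iff[OF sw] w unfolding W_def by simp
      then show False using False by (simp add: S_def)
    qed
    then have Wp: "0 < W" using W0 by simp
    define t where "t = (S / W) powr (1 / p)"
    have t: "0 < t" and tp: "t powr p = S / W"
      using Sp Wp p by (auto simp: t_def powr_powr)
    have le: "w n * c n \<le> (t * (1 - 1 / p)) * w n + t / (p * t powr p) * (w n * c n powr p)" for n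
    proof -
      have "c n / t \<le> (1 - 1 / p) + (c n / t) powr p / p" using t c by (intro tangent) simp
      then have "c n \<le> t * ((1 - 1 / p) + (c n / t) powr p / p)"
        using t by (simp add: pos_divide_le_eq mult.commute)
      also have "\<dots> = t * (1 - 1 / p) + t / (p * t powr p) * c n powr p"
        using t c[of n] by (simp add: powr_divide algebra_simps)
      finally show ?thesis using mult_left_mono[OF _ w[of n]] by (fastforce simp: algebra_simps)
    qed
    have "(\<Sum>n. w n * c n) \<le> (\<Sum>n. (t * (1 - 1 / p)) * w n + t / (p * t powr p) * (w n * c n powr p))"
      using le swc sw sc by (intro suminf_le summable_add summable_mult) auto
    also have "\<dots> = t * (1 - 1 / p) * W + t / (p * t powr p) * S"
      unfolding W_def S_def
      by (simp only: suminf_mult[OF sw] suminf_mult[OF sc]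
          suminf_add[OF summable_mult[OF sw] summable_mult[OF sc], symmetric])
    also have "\<dots> = t * W"
      unfolding tp using Sp Wp p by (simp add: field_simps)
    finally have "(\<Sum>n. w n * c n) powr p \<le> (t * W) powr p"
      using swc w c p by (intro powr_mono2 suminf_nonneg) auto
    also have "\<dots> = W powr (p - 1) * S"
      using Wp Sp t by (simp add: powr_mult tp powr_diff)
    finally show ?thesis by (simp add: W_def S_def)
  qed
qed

section \<open>Nonnegative functions on the half-line\<close>

lemma
  fixes f :: "real \<Rightarrow> real"
  assumes f: "f integrable_on {0<..}" and nn: "\<And>x. 0 < x \<Longrightarrow> 0 \<le> f x" and a: "0 < a"
  shows nonneg_integrable_on_subinterval: "f integrable_on {a..b}"
    and integral_subinterval_le: "integral {a..b} f \<le> integral {0<..} f"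
proof -
  have "f absolutely_integrable_on {0<..}"
    using f nn by (intro nonnegative_absolutely_integrable_1) auto
  then have "f absolutely_integrable_on {a..b}"
    by (rule set_integrable_subset) (use a in auto)
  then show sub: "f integrable_on {a..b}" by (rule set_lebesgue_integral_eq_integral)
  show "integral {a..b} f \<le> integral {0<..} f"
    using a nn sub f by (intro integral_subset_le) auto
qed

lemma ln_le_integral:
  fixes f :: "real \<Rightarrow> real"
  assumes f: "integrable (lebesgue_on {0<..}) f" and nn: "\<And>x. 0 < x \<Longrightarrow> 0 \<le> f x"
    and ab: "0 < a" "a \<le> b" and ge: "\<And>x. a \<le> x \<Longrightarrow> x \<le> b \<Longrightarrow> 1 / x \<le> f x"
  shows "ln (b / a) \<le> (LINT x|lebesgue_on {0<..}. f x)"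
proof -
  have f_on: "f integrable_on {0<..}"
    and f_eq: "(LINT x|lebesgue_on {0<..}. f x) = integral {0<..} f"
    using f lebesgue_integral_eq_integral[OF f] by (auto intro: integrable_on_lebesgue_on)
  have f_ab: "f integrable_on {a..b}"
    using nonneg_integrable_on_subinterval[OF f_on nn ab(1)] .
  have "((\<lambda>x. 1 / x) has_integral (ln b - ln a)) {a..b}"
    using ab by (intro fundamental_theorem_of_calculus)
      (auto intro!: derivative_eq_intros simp flip: has_real_derivative_iff_has_vector_derivative)
  then have "ln b - ln a \<le> integral {a..b} f"
    using ge by (intro has_integral_le[OF _ integrable_integral[OF f_ab]]) auto
  also have "\<dots> \<le> integral {0<..} f"
    by (rule integral_subinterval_le[OF f_on nn ab(1)])
  finally show ?thesis using ab f_eq by (simp add: ln_div)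
qed

section \<open>The homogeneous kernel\<close>

text \<open>
  For positive \<open>u\<close> and \<open>x\<close> this is \<open>min ((u/x)\<^sup>s) ((x/u)\<^sup>t)\<close> whenever \<open>s, t \<ge> 0\<close>: a kernel of degree 0 that
  is 1 on the diagonal and, for positive \<open>s\<close> and \<open>t\<close>, decays like a power on either side of it.
\<close>

definition hardy_kernel :: "real \<Rightarrow> real \<Rightarrow> real \<Rightarrow> real \<Rightarrow> real" where
  "hardy_kernel s t u x = u powr s * x powr t / max u x powr (s + t)"

text \<open>
  This symmetry turns every statement about one variable into the statement about the other.
\<close>

lemma hardy_kernel_swap: "hardy_kernel s t u x = hardy_kernel t s x u"
  by (simp add: hardy_kernel_def max.commute add.commute mult.commute)

lemma hardy_kernel_nonneg: "0 \<le> hardy_kernel s t u x"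
  by (simp add: hardy_kernel_def)

lemma hardy_kernel_left: "0 < u \<Longrightarrow> u \<le> x \<Longrightarrow> hardy_kernel s t u x = (u / x) powr s"
  by (simp add: hardy_kernel_def powr_add powr_divide max_def)

lemma hardy_kernel_right: "0 < x \<Longrightarrow> x \<le> u \<Longrightarrow> hardy_kernel s t u x = (x / u) powr t"
  by (metis hardy_kernel_left hardy_kernel_swap)

lemma hardy_kernel_le_1:
  assumes "0 \<le> s" "0 \<le> t" "0 < u" "0 < x"
  shows "hardy_kernel s t u x \<le> 1"
proof (cases "u \<le> x")
  case True
  then show ?thesis using assms by (simp add: hardy_kernel_left powr_le1)
next
  case False
  then show ?thesis using assms by (simp add: hardy_kernel_right powr_le1)
qed

text \<open>
  The operator kernel can thus be split into two equal factors that both still decay, so that one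
  of them can be spent on the sum over the integers and the other on the integral.
\<close>

lemma hardy_kernel_square:
  "hardy_kernel s t u x * hardy_kernel s t u x = hardy_kernel (2 * s) (2 * t) u x"
proof -
  have sq: "y powr (2 * r) = y powr r * y powr r" for y r :: real
    by (simp add: powr_add[symmetric])
  show ?thesis
    unfolding hardy_kernel_def distrib_left[symmetric] sq by simp
qed

text \<open>
  The kernel is a pure power on each side of \<open>x\<close>, so the measure \<open>du/u\<close> gives it the mass \<open>1/s\<close>
  on the left and \<open>1/t\<close> on the right. By homogeneity the total does not depend on \<open>x\<close>.
\<close>

lemma has_integral_hardy_kernel:
  assumes s: "0 < s" and t: "0 < t" and x: "0 < x"
  shows "((\<lambda>u. hardy_kernel s t u x / u) has_integral (1 / s + 1 / t)) {0<..}"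
proof -
  \<comment> \<open>On the left piece the two integrands agree at \<open>u = 0\<close> as well, since both are 0 there.\<close>
  have "((\<lambda>u. x powr (- s) * u powr (s - 1)) has_integral
      x powr (- s) * (x powr (s - 1 + 1) / (s - 1 + 1))) {0..x}"
    using has_integral_powr_from_0[of "s - 1" x] s x by (intro has_integral_mult_right) auto
  moreover have "x powr (- s) * (x powr (s - 1 + 1) / (s - 1 + 1)) = 1 / s"
    using x s by (simp add: powr_minus)
  moreover have "x powr (- s) * u powr (s - 1) = hardy_kernel s t u x / u" if "u \<in> {0..x}" for u
  proof (cases "u = 0")
    case False
    then show ?thesis using that x
      by (simp add: hardy_kernel_left powr_divide powr_minus powr_diff field_simps)
  qed simp
  ultimately have left: "((\<lambda>u. hardy_kernel s t u x / u) has_integral 1 / s) {0..x}"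
    by (metis (no_types, lifting) has_integral_cong)
  have "((\<lambda>u. x powr t * u powr (- t - 1)) has_integral
      x powr t * (- (x powr (- t - 1 + 1)) / (- t - 1 + 1))) {x..}"
    using has_integral_powr_to_inf[of "- t - 1" x] t x by (intro has_integral_mult_right) auto
  moreover have "x powr t * (- (x powr (- t - 1 + 1)) / (- t - 1 + 1)) = 1 / t"
    using x t by (simp add: powr_minus)
  moreover have "x powr t * u powr (- t - 1) = hardy_kernel s t u x / u" if "u \<in> {x..}" for u
    using that x by (simp add: hardy_kernel_right powr_divide powr_minus powr_diff field_simps)
  ultimately have right: "((\<lambda>u. hardy_kernel s t u x / u) has_integral 1 / t) {x..}"
    by (metis (no_types, lifting) has_integral_cong)
  have "((\<lambda>u. hardy_kernel s t u x / u) has_integral (1 / s + 1 / t)) ({0..x} \<union> {x..})"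
  proof (rule has_integral_Un[OF left right])
    have "{0..x} \<inter> {x..} = {x}" using x by auto
    then show "negligible ({0..x} \<inter> {x..})" by simp
  qed
  moreover have "{0..x} \<union> {x..} = insert 0 {0<..}" using x by auto
  ultimately have "((\<lambda>u. hardy_kernel s t u x / u) has_integral (1 / s + 1 / t)) (insert 0 {0<..})"
    by simp
  moreover have "((\<lambda>u. hardy_kernel s t u x / u) has_integral (1 / s + 1 / t)) (insert 0 {0<..})
      \<longleftrightarrow> ((\<lambda>u. hardy_kernel s t u x / u) has_integral (1 / s + 1 / t)) {0<..}"
    by (rule has_integral_spike_set_eq; rule negligible_subset[of "{0}"]) auto
  ultimately show ?thesis by simp
qed

lemma
  assumes s: "0 < s" and t: "0 < t" and u: "0 < u"
  shows integrable_hardy_kernel: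
      "integrable (lebesgue_on {0<..}) (\<lambda>x. hardy_kernel s t u x / x)"
    and integral_hardy_kernel:
      "(LINT x|lebesgue_on {0<..}. hardy_kernel s t u x / x) = 1 / s + 1 / t"
proof -
  have I: "((\<lambda>x. hardy_kernel s t u x / x) has_integral (1 / s + 1 / t)) {0<..}"
    using has_integral_hardy_kernel[OF t s u] by (simp add: hardy_kernel_swap add.commute)
  then have "(\<lambda>x. hardy_kernel s t u x / x) absolutely_integrable_on {0<..}"
    by (intro nonnegative_absolutely_integrable_1) (auto simp: hardy_kernel_nonneg)
  then show *: "integrable (lebesgue_on {0<..}) (\<lambda>x. hardy_kernel s t u x / x)"
    by (simp add: set_integrable_def integrable_restrict_space)
  show "(LINT x|lebesgue_on {0<..}. hardy_kernel s t u x / x) = 1 / s + 1 / t"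
    using lebesgue_integral_eq_integral[OF *] I by (simp add: integral_unique)
qed

text \<open>
  Within one octave the integrand changes at most by a constant factor, because each power in it
  does. This allows a sum over integers to be compared with the integral.
\<close>

lemma hardy_kernel_doubling:
  assumes s: "0 < s" and t: "0 < t" and x: "0 < x" and m: "0 < m" "m \<le> u" "u \<le> 2 * m"
  shows "hardy_kernel s t m x / m \<le> 2 powr (s + t + 1) * (hardy_kernel s t u x / u)"
proof -
  have "max u x powr (s + t) \<le> (2 * max m x) powr (s + t)"
    using assms by (intro powr_mono2) (auto simp: max_def)
  also have "\<dots> = 2 powr (s + t) * max m x powr (s + t)"
    using m by (simp add: powr_mult)
  finally have M: "max u x powr (s + t) \<le> 2 powr (s + t) * max m x powr (s + t)" .
  have "u * max u x powr (s + t) \<le> (2 * m) * (2 powr (s + t) * max m x powr (s + t))"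
    using m M by (intro mult_mono) auto
  also have "\<dots> = 2 powr (s + t + 1) * (m * max m x powr (s + t))"
    by (simp add: powr_add)
  finally have D: "u * max u x powr (s + t) \<le> 2 powr (s + t + 1) * (m * max m x powr (s + t))" .
  have "hardy_kernel s t m x / m = m powr s * x powr t / (m * max m x powr (s + t))"
    by (simp add: hardy_kernel_def mult.commute)
  also have "\<dots> \<le> u powr s * x powr t / (m * max m x powr (s + t))"
    using m s x by (intro divide_right_mono mult_right_mono powr_mono2) auto
  also have "\<dots> \<le> u powr s * x powr t * 2 powr (s + t + 1) / (u * max u x powr (s + t))"
  proof -
    have pos: "0 < m * max m x powr (s + t)" "0 < u * max u x powr (s + t)" using m x by auto
    have "u powr s * x powr t * (u * max u x powr (s + t))
        \<le> u powr s * x powr t * (2 powr (s + t + 1) * (m * max m x powr (s + t)))"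
      using D by (intro mult_left_mono) auto
    then show ?thesis using pos by (simp add: divide_simps mult_ac)
  qed
  also have "\<dots> = 2 powr (s + t + 1) * (hardy_kernel s t u x / u)"
    by (simp add: hardy_kernel_def mult_ac)
  finally show ?thesis .
qed

text \<open>
  The term at \<open>m\<close> is at most a constant times the integral over \<open>[m, m + 1]\<close>, an interval that stays
  within the octave \<open>[m, 2m]\<close> because \<open>m \<ge> 1\<close>. The bound is uniform in \<open>x\<close>.
\<close>

lemma
  assumes s: "0 < s" and t: "0 < t" and x: "0 < x"
  shows summable_hardy_kernel: "summable (\<lambda>n. hardy_kernel s t (real (Suc n)) x / real (Suc n))"
    and suminf_hardy_kernel_le: "(\<Sum>n. hardy_kernel s t (real (Suc n)) x / real (Suc n))
      \<le> 2 powr (s + t + 1) * (1 / s + 1 / t)"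
proof -
  let ?f = "\<lambda>u. hardy_kernel s t u x / u"
  let ?C = "2 powr (s + t + 1) :: real"
  have int: "?f integrable_on {0<..}" and I: "integral {0<..} ?f = 1 / s + 1 / t"
    using has_integral_hardy_kernel[OF s t x] by (auto simp: has_integral_iff)
  have nn: "0 \<le> ?f u" if "0 < u" for u using that by (simp add: hardy_kernel_nonneg)
  have sub: "?f integrable_on {a..b}" if "0 < a" for a b
    using nonneg_integrable_on_subinterval[OF int nn that] .
  have step: "?f (real (Suc n)) \<le> ?C * integral {real (Suc n)..real (Suc (Suc n))} ?f" for n
  proof -
    let ?I = "{real (Suc n)..real (Suc (Suc n))}"
    have "?f (real (Suc n)) = integral ?I (\<lambda>u. ?f (real (Suc n)))" by simp
    also have "\<dots> \<le> integral ?I (\<lambda>u. ?C * ?f u)"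
    proof (rule integral_le)
      show "(\<lambda>u. ?C * ?f u) integrable_on ?I"
        using sub[of "real (Suc n)"] by (intro integrable_on_mult_right) auto
      show "?f (real (Suc n)) \<le> ?C * ?f u" if "u \<in> ?I" for u
        using that by (intro hardy_kernel_doubling s t x) auto
    qed (simp add: integrable_const_ivl)
    also have "\<dots> = ?C * integral ?I ?f" by (rule integral_mult_right)
    finally show ?thesis .
  qed
  have partial: "(\<Sum>n<N. ?f (real (Suc n))) \<le> ?C * integral {1..real (Suc N)} ?f" for N
  proof (induction N)
    case (Suc N)
    have "integral {1..real (Suc N)} ?f + integral {real (Suc N)..real (Suc (Suc N))} ?f
        = integral {1..real (Suc (Suc N))} ?f"
      by (rule Henstock_Kurzweil_Integration.integral_combine) (auto intro: sub)
    then have "?C * integral {1..real (Suc N)} ?f + ?C * integral {real (Suc N)..real (Suc (Suc N))} ?f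
        = ?C * integral {1..real (Suc (Suc N))} ?f"
      by (simp only: distrib_left[symmetric])
    then show ?case using Suc step[of N] unfolding sum.lessThan_Suc by linarith
  qed simp
  have bound: "(\<Sum>n<N. ?f (real (Suc n))) \<le> ?C * (1 / s + 1 / t)" for N
  proof -
    have "integral {1..real (Suc N)} ?f \<le> integral {0<..} ?f"
      by (rule integral_subinterval_le[OF int nn]) auto
    then show ?thesis using partial[of N] unfolding I
      by (meson mult_left_mono order_trans powr_ge_zero)
  qed
  show "summable (\<lambda>n. ?f (real (Suc n)))"
    by (rule summableI_nonneg_bounded[OF _ bound]) (simp add: hardy_kernel_nonneg)
  then show "(\<Sum>n. ?f (real (Suc n))) \<le> ?C * (1 / s + 1 / t)"
    by (rule suminf_le_const) (rule bound)
qed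

section \<open>Necessity\<close>

text \<open>
  Within one octave every power is comparable with its value at the left end, whatever the sign of
  the exponent.
\<close>

lemma powr_dyadic_bounds:
  fixes N y c :: real
  assumes N: "0 < N" and y: "N \<le> y" "y \<le> 2 * N"
  shows "2 powr (- \<bar>c\<bar>) * N powr c \<le> y powr c" and "y powr c \<le> 2 powr \<bar>c\<bar> * N powr c"
proof -
  define r where "r = y / N"
  have r: "1 \<le> r" "r \<le> 2" and yr: "y powr c = r powr c * N powr c"
    using assms by (auto simp: r_def powr_divide field_simps)
  have "\<bar>c * ln r\<bar> \<le> \<bar>c\<bar> * ln 2"
    using r by (auto simp: abs_mult intro!: mult_left_mono)
  then have "2 powr (- \<bar>c\<bar>) \<le> r powr c" "r powr c \<le> 2 powr \<bar>c\<bar>"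
    using r by (auto simp: powr_def)
  then show "2 powr (- \<bar>c\<bar>) * N powr c \<le> y powr c" "y powr c \<le> 2 powr \<bar>c\<bar> * N powr c"
    unfolding yr by (auto intro: mult_right_mono)
qed

text \<open>
  The form in which scaling arguments are used: an inequality between powers that holds, up to
  constants, at all scales orders the exponents.
\<close>

lemma powr_exponent_le:
  fixes A B e f :: real
  assumes A: "0 < A" and le: "\<And>N::nat. 1 \<le> N \<Longrightarrow> A * real N powr e \<le> B * real N powr f"
  shows "e \<le> f"
proof (rule ccontr)
  assume "\<not> e \<le> f"
  then have ef: "0 < e - f" by simp
  define M where "M = \<bar>B / A\<bar> + 1"
  have M: "0 < M" "B / A < M" unfolding M_def by linarith+
  define r where "r = M powr (1 / (e - f))"
  have "0 < r" using M by (simp add: r_def)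
  obtain N :: nat where N: "r < real N" using reals_Archimedean2 by blast
  with \<open>0 < r\<close> have N0: "0 < real N" by linarith
  note M(2)
  also have "M = r powr (e - f)" using ef M by (simp add: r_def powr_powr)
  also have "\<dots> < real N powr (e - f)" using N \<open>0 < r\<close> ef by (intro powr_less_mono2) auto
  finally have "B / A < real N powr (e - f)" .
  then have "B * real N powr f < A * real N powr e"
    using A N0 by (simp add: powr_diff field_simps)
  then show False using le[of N] N0 by simp
qed

text \<open>
  The function is a pure power on either side of 1. If an exponent is on the wrong side of
  \<open>-1\<close>, the function dominates \<open>1/x\<close> there, and the integral of \<open>1/x\<close> over \<open>[1/R, 1]\<close> or \<open>[1, R]\<close>
  is \<open>ln R\<close>.
\<close>

lemma integrable_powr_pieces:
  fixes b c :: real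
  assumes int: "integrable (lebesgue_on {0<..}) (\<lambda>x. x powr b / max 1 x powr c)"
  shows "-1 < b" and "b - c < -1"
proof -
  let ?f = "\<lambda>x. x powr b / max 1 x powr c"
  define J where "J = (LINT x|lebesgue_on {0<..}. ?f x)"
  have J: "0 \<le> J" unfolding J_def by (intro integral_nonneg_AE) auto
  \<comment> \<open>Chosen so that \<open>ln R\<close> exceeds the supposed value \<open>J\<close> of the integral.\<close>
  define R where "R = exp (J + 1)"
  have R: "1 \<le> R" "0 < R" "ln R = J + 1" using J by (auto simp: R_def)
  show "-1 < b"
  proof (rule ccontr)
    assume b: "\<not> -1 < b"
    have "ln (1 / (1 / R)) \<le> J"
      unfolding J_def
    proof (rule ln_le_integral[OF int])
      fix x assume x: "1 / R \<le> x" "x \<le> 1"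
      have "0 < x" by (rule less_le_trans[OF _ x(1)]) (use R in simp)
      then have "x powr (-1) \<le> x powr b" using b x by (intro powr_mono') auto
      then show "1 / x \<le> ?f x" using \<open>0 < x\<close> x by (simp add: powr_minus_divide)
    qed (use R in auto)
    then show False using R by simp
  qed
  show "b - c < -1"
  proof (rule ccontr)
    assume b: "\<not> b - c < -1"
    have "ln (R / 1) \<le> J"
      unfolding J_def
    proof (rule ln_le_integral[OF int])
      fix x assume x: "1 \<le> x" "x \<le> R"
      then have "x powr (-1) \<le> x powr (b - c)" using b by (intro powr_mono) auto
      then show "1 / x \<le> ?f x" using x by (simp add: powr_minus_divide powr_diff)
    qed (use R in auto)
    then show False using R by simp
  qed
qed

text \<open>
  The image of the first unit sequence is \<open>x\<^sup>\<beta>\<close> on \<open>(0, 1]\<close> and \<open>x\<close> to the power \<open>\<beta> - lam\<close> beyond; its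
  integrability at 0 and at infinity gives the two inequalities, which are strict because \<open>1/x\<close>
  is integrable at neither end.
\<close>

lemma H_bounded_imp_endpoint_conditions:
  assumes q: "0 < q" and H: "H_bounded lam \<alpha> \<beta> p \<phi> q \<psi>"
  shows "- q * \<beta> < \<psi> + 1" and "\<psi> + 1 < q * (lam - \<beta>)"
proof -
  define a :: "nat \<Rightarrow> real" where "a = (\<lambda>n. if n = 1 then 1 else 0)"
  have supp: "n \<notin> {0} \<Longrightarrow> a (Suc n) = 0" for n by (simp add: a_def)
  have "a \<in> seq_space p \<phi>"
    unfolding seq_space_def mem_Collect_eq
    by (rule summable_finite[of "{0}"]) (use supp in auto)
  then have mem: "H_op lam \<alpha> \<beta> a \<in> fun_space q \<psi>" using H by (auto simp: H_bounded_def)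
  have H_eq: "H_op lam \<alpha> \<beta> a x = x powr \<beta> / max 1 x powr lam" for x
  proof -
    have "H_op lam \<alpha> \<beta> a x = (\<Sum>n\<in>{0}. H_term lam \<alpha> \<beta> a x (Suc n))"
      unfolding H_op_def by (rule suminf_finite) (use supp in \<open>auto simp: H_term_def\<close>)
    then show ?thesis by (simp add: H_term_def a_def)
  qed
  have int: "integrable (lebesgue_on {0<..}) (\<lambda>x. \<bar>H_op lam \<alpha> \<beta> a x\<bar> powr q * x powr \<psi>)"
    using mem by (simp add: fun_space_def)
  have "\<bar>H_op lam \<alpha> \<beta> a x\<bar> powr q * x powr \<psi> = x powr (q * \<beta> + \<psi>) / max 1 x powr (q * lam)" for x
    by (simp add: H_eq powr_divide powr_powr powr_add mult.commute)
  with int have "integrable (lebesgue_on {0<..}) (\<lambda>x. x powr (q * \<beta> + \<psi>) / max 1 x powr (q * lam))"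
    by simp
  from integrable_powr_pieces[OF this]
  show "- q * \<beta> < \<psi> + 1" "\<psi> + 1 < q * (lam - \<beta>)" by (auto simp: algebra_simps)
qed

text \<open>
  Test sequence: the indicator of the octave \<open>[N, 2N)\<close>. Its norm is at most of order
  \<open>N\<close> to the power \<open>(\<phi> + 1)/p\<close>. On \<open>[N, 2N]\<close> all \<open>N\<close> terms of the image have order at least \<open>N\<close> to
  the power \<open>\<alpha> + \<beta> - lam\<close>, so the norm of the image has order at least \<open>N\<close> to the power
  \<open>\<alpha> + \<beta> + 1 - lam + (\<psi> + 1)/q\<close>. Letting \<open>N\<close> grow compares the exponents.
\<close>

lemma H_bounded_imp_scaling_condition:
  assumes p: "0 < p" and q: "0 < q" and H: "H_bounded lam \<alpha> \<beta> p \<phi> q \<psi>"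
  shows "\<alpha> + \<beta> + 1 + (\<psi> + 1) / q - (\<phi> + 1) / p \<le> lam"
proof -
  obtain C where C: "\<And>a. a \<in> seq_space p \<phi> \<Longrightarrow> H_op lam \<alpha> \<beta> a \<in> fun_space q \<psi> \<and>
      fun_norm q \<psi> (H_op lam \<alpha> \<beta> a) \<le> C * seq_norm p \<phi> a"
    using H by (auto simp: H_bounded_def)
  define d where "d = 2 powr (- \<bar>\<alpha>\<bar>) * 2 powr (- \<bar>\<beta>\<bar>) / (2 powr \<bar>lam\<bar>)"
  have d: "0 < d" by (simp add: d_def)
  define A where "A = (d powr q * 2 powr (- \<bar>\<psi>\<bar>)) powr (1 / q)"
  \<comment> \<open>Boundedness does not prescribe the sign of \<open>C\<close>.\<close>
  define B where "B = \<bar>C\<bar> * (2 powr \<bar>\<phi>\<bar>) powr (1 / p)"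
  have "A * real N powr (\<alpha> + \<beta> - lam + 1 + (\<psi> + 1) / q) \<le> B * real N powr ((\<phi> + 1) / p)"
    if N: "1 \<le> N" for N :: nat
  proof -
    define a :: "nat \<Rightarrow> real" where "a = indicator {N..<2 * N}"
    \<comment> \<open>Summation runs over \<open>n\<close> with the sequence read at \<open>Suc n\<close>, so the octave is shifted down by 1.\<close>
    let ?I = "{N - 1..<2 * N - 1}"
    have cI: "card ?I = N" using N by simp
    have aI: "a (Suc n) = 1" if "n \<in> ?I" for n using that N by (auto simp: a_def indicator_def)
    have aI': "a (Suc n) = 0" if "n \<notin> ?I" for n using that N by (auto simp: a_def indicator_def)
    have dyad: "real N \<le> real (Suc n)" "real (Suc n) \<le> 2 * real N" if "n \<in> ?I" for n
      using that N by auto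
    have N0: "0 < real N" using N by simp
    have mem: "a \<in> seq_space p \<phi>"
      unfolding seq_space_def mem_Collect_eq
      by (rule summable_finite[of ?I]) (use aI' in auto)
    have "(\<Sum>n. real (Suc n) powr \<phi> * \<bar>a (Suc n)\<bar> powr p)
        = (\<Sum>n\<in>?I. real (Suc n) powr \<phi> * \<bar>a (Suc n)\<bar> powr p)"
      by (rule suminf_finite) (use aI' in auto)
    also have "\<dots> \<le> (\<Sum>n\<in>?I. 2 powr \<bar>\<phi>\<bar> * real N powr \<phi>)"
    proof (rule sum_mono)
      show "real (Suc n) powr \<phi> * \<bar>a (Suc n)\<bar> powr p \<le> 2 powr \<bar>\<phi>\<bar> * real N powr \<phi>"
        if "n \<in> ?I" for n
        using powr_dyadic_bounds(2)[OF N0 dyad[OF that]] by (simp add: aI[OF that])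
    qed
    also have "\<dots> = 2 powr \<bar>\<phi>\<bar> * real N powr (\<phi> + 1)"
      using cI N0 by (simp add: powr_add del: card_atLeastLessThan)
    finally have S: "(\<Sum>n. real (Suc n) powr \<phi> * \<bar>a (Suc n)\<bar> powr p)
        \<le> 2 powr \<bar>\<phi>\<bar> * real N powr (\<phi> + 1)" .
    have "seq_norm p \<phi> a \<le> (2 powr \<bar>\<phi>\<bar> * real N powr (\<phi> + 1)) powr (1 / p)"
      unfolding seq_norm_def using S mem p
      by (intro powr_mono2 suminf_nonneg) (auto simp: seq_space_def)
    also have "\<dots> = (2 powr \<bar>\<phi>\<bar>) powr (1 / p) * real N powr ((\<phi> + 1) / p)"
      by (simp add: powr_mult powr_powr)
    finally have "\<bar>C\<bar> * seq_norm p \<phi> a \<le> B * real N powr ((\<phi> + 1) / p)"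
      unfolding B_def mult.assoc by (rule mult_left_mono) simp
    moreover have "C * seq_norm p \<phi> a \<le> \<bar>C\<bar> * seq_norm p \<phi> a"
      by (intro mult_right_mono) (auto simp: seq_norm_def)
    ultimately have upper: "fun_norm q \<psi> (H_op lam \<alpha> \<beta> a) \<le> B * real N powr ((\<phi> + 1) / p)"
      using C[OF mem] by linarith
    have Hlow: "d * real N powr (\<alpha> + \<beta> - lam + 1) \<le> H_op lam \<alpha> \<beta> a x"
      if x: "real N \<le> x" "x \<le> 2 * real N" for x
    proof -
      have x0: "0 < x" using x N0 by simp
      have "H_op lam \<alpha> \<beta> a x = (\<Sum>n\<in>?I. H_term lam \<alpha> \<beta> a x (Suc n))"
        unfolding H_op_def by (rule suminf_finite) (use aI' in \<open>auto simp: H_term_def\<close>)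
      moreover have "(\<Sum>n\<in>?I. d * real N powr (\<alpha> + \<beta> - lam)) \<le> \<dots>"
      proof (rule sum_mono)
        fix n assume n: "n \<in> ?I"
        have "d * real N powr (\<alpha> + \<beta> - lam) = (2 powr (- \<bar>\<alpha>\<bar>) * real N powr \<alpha>)
            * (2 powr (- \<bar>\<beta>\<bar>) * real N powr \<beta>) / (2 powr \<bar>lam\<bar> * real N powr lam)"
          by (simp add: d_def powr_diff powr_add)
        also have "\<dots> \<le> real (Suc n) powr \<alpha> * x powr \<beta> / max (real (Suc n)) x powr lam"
        proof (rule frac_le)
          show "(2 powr (- \<bar>\<alpha>\<bar>) * real N powr \<alpha>) * (2 powr (- \<bar>\<beta>\<bar>) * real N powr \<beta>)
              \<le> real (Suc n) powr \<alpha> * x powr \<beta>"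
            using powr_dyadic_bounds(1)[OF N0 dyad[OF n]] powr_dyadic_bounds(1)[OF N0 x]
            by (intro mult_mono) auto
          show "max (real (Suc n)) x powr lam \<le> 2 powr \<bar>lam\<bar> * real N powr lam"
            by (rule powr_dyadic_bounds(2)[OF N0]) (use dyad[OF n] x in \<open>auto simp: max_def\<close>)
        qed (use x0 in auto)
        also have "\<dots> = H_term lam \<alpha> \<beta> a x (Suc n)" by (simp add: H_term_def aI[OF n])
        finally show "d * real N powr (\<alpha> + \<beta> - lam) \<le> H_term lam \<alpha> \<beta> a x (Suc n)" .
      qed
      moreover have "(\<Sum>n\<in>?I. d * real N powr (\<alpha> + \<beta> - lam)) = d * real N powr (\<alpha> + \<beta> - lam + 1)"
        using cI N0 by (simp add: powr_add del: card_atLeastLessThan)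
      ultimately show ?thesis by linarith
    qed
    let ?F = "\<lambda>x. \<bar>H_op lam \<alpha> \<beta> a x\<bar> powr q * x powr \<psi>"
    define L where "L = (d * real N powr (\<alpha> + \<beta> - lam + 1)) powr q * (2 powr (- \<bar>\<psi>\<bar>) * real N powr \<psi>)"
    have Flow: "L \<le> ?F x" if x: "real N \<le> x" "x \<le> 2 * real N" for x
      unfolding L_def
    proof (rule mult_mono)
      show "(d * real N powr (\<alpha> + \<beta> - lam + 1)) powr q \<le> \<bar>H_op lam \<alpha> \<beta> a x\<bar> powr q"
        using Hlow[OF x] d q by (intro powr_mono2) auto
      show "2 powr (- \<bar>\<psi>\<bar>) * real N powr \<psi> \<le> x powr \<psi>"
        by (rule powr_dyadic_bounds(1)[OF N0 x])
    qed auto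
    have Fint: "integrable (lebesgue_on {0<..}) ?F"
      using C[OF mem] by (simp add: fun_space_def)
    have F_on: "?F integrable_on {0<..}" using Fint by (rule integrable_on_lebesgue_on) simp
    have F_N: "?F integrable_on {real N..2 * real N}"
      using N0 by (intro nonneg_integrable_on_subinterval[OF F_on]) auto
    have "L * real N = integral {real N..2 * real N} (\<lambda>x. L)" by simp
    also have "\<dots> \<le> integral {real N..2 * real N} ?F"
      using F_N Flow by (intro integral_le) auto
    also have "\<dots> \<le> integral {0<..} ?F"
      using N0 by (intro integral_subinterval_le[OF F_on]) auto
    also have "\<dots> = (LINT x|lebesgue_on {0<..}. ?F x)"
      using lebesgue_integral_eq_integral[OF Fint] by simp
    finally have "(L * real N) powr (1 / q) \<le> fun_norm q \<psi> (H_op lam \<alpha> \<beta> a)"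
      unfolding fun_norm_def using q by (intro powr_mono2) (auto simp: L_def)
    moreover have "(L * real N) powr (1 / q) = A * real N powr (\<alpha> + \<beta> - lam + 1 + (\<psi> + 1) / q)"
    proof -
      let ?e = "\<alpha> + \<beta> - lam + 1"
      have "L * real N = (d powr q * 2 powr (- \<bar>\<psi>\<bar>)) * real N powr (?e * q + (\<psi> + 1))"
      proof -
        have "L * real N = (d powr q * 2 powr (- \<bar>\<psi>\<bar>))
            * (real N powr (?e * q) * (real N powr \<psi> * real N powr 1))"
          using N0 by (simp only: L_def powr_mult powr_powr powr_one mult_ac)
        then show ?thesis by (simp only: powr_add)
      qed
      then have "(L * real N) powr (1 / q) = A * real N powr ((?e * q + (\<psi> + 1)) * (1 / q))"
        by (simp only: A_def powr_mult powr_powr)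
      also have "(?e * q + (\<psi> + 1)) * (1 / q) = ?e + (\<psi> + 1) / q"
        using q by (simp add: field_simps)
      finally show ?thesis .
    qed
    ultimately show ?thesis using upper by linarith
  qed
  moreover have "0 < A" using d by (simp add: A_def)
  ultimately have "\<alpha> + \<beta> - lam + 1 + (\<psi> + 1) / q \<le> (\<phi> + 1) / p"
    by (rule powr_exponent_le[rotated])
  then show ?thesis by simp
qed

section \<open>Sufficiency\<close>

text \<open>
  The pointwise estimate behind boundedness. One factor \<open>k\<close> together with \<open>1/m\<close> serves as a weight
  of total mass at most \<open>V\<close>, uniformly in \<open>x\<close>; the power mean inequality with exponent \<open>p\<close> bounds the
  \<open>p\<close>-th power of the sum by a multiple of \<open>Z = \<Sum> k\<^sup>p b\<^sup>p\<close>. A second power mean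
  inequality, with weights \<open>b\<^sup>p\<close> and exponent \<open>q/p \<ge> 1\<close>, brings the power \<open>q/p\<close> of \<open>Z\<close> inside the sum; this is the point where \<open>p \<le> q\<close> is used. Since \<open>k \<le> 1\<close>,
  all surplus powers of \<open>k\<close> can be dropped, and the one that remains makes the bound integrable in \<open>x\<close>.
\<close>

lemma hardy_kernel_power_mean:
  fixes b :: "nat \<Rightarrow> real" and p q s t x :: real
  defines "k \<equiv> \<lambda>n. hardy_kernel s t (real (Suc n)) x"
    and "V \<equiv> 2 powr (s + t + 1) * (1 / s + 1 / t)"
  assumes p: "1 \<le> p" and pq: "p \<le> q" and s: "0 < s" and t: "0 < t" and x: "0 < x"
    and b: "\<And>n. 0 \<le> b n" and sb: "summable (\<lambda>n. b n powr p)"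
  shows "summable (\<lambda>n. k n * k n * real (Suc n) powr (1 / p - 1) * b n)" (is "summable ?T")
    and "(\<Sum>n. k n * k n * real (Suc n) powr (1 / p - 1) * b n) powr q
      \<le> V powr ((p - 1) * q / p) * (\<Sum>n. b n powr p) powr (q / p - 1) * (\<Sum>n. b n powr p * k n)"
    and "summable (\<lambda>n. b n powr p * k n)"
proof -
  have k0: "0 \<le> k n" for n by (simp add: k_def hardy_kernel_nonneg)
  have k1: "k n \<le> 1" for n unfolding k_def using s t x by (intro hardy_kernel_le_1) auto
  define w c where "w = (\<lambda>n. k n / real (Suc n))"
    and "c = (\<lambda>n. k n * real (Suc n) powr (1 / p) * b n)"
  have w0: "0 \<le> w n" and c0: "0 \<le> c n" for n using k0 b by (auto simp: w_def c_def)
  have sw: "summable w" and wV: "(\<Sum>n. w n) \<le> V"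
    unfolding w_def k_def V_def
    using summable_hardy_kernel[OF s t x] suminf_hardy_kernel_le[OF s t x] by auto
  have wc: "?T = (\<lambda>n. w n * c n)"
    by (simp add: w_def c_def powr_diff fun_eq_iff)
  have wcp: "w n * c n powr p = k n * (b n powr p * k n powr p)" for n
    using p k0[of n] b[of n] by (simp add: w_def c_def powr_mult powr_powr)
  have wcp_le: "w n * c n powr p \<le> b n powr p * k n powr p" for n
    unfolding wcp using k0 k1 by (intro mult_left_le_one_le) auto
  have summ: "summable (\<lambda>n. b n powr p * k n powr r)" if "0 \<le> r" for r
    by (rule summable_comparison_test'[OF sb])
      (use k0 k1 that in \<open>auto intro!: mult_right_le_one_le powr_le1\<close>)
  show "summable (\<lambda>n. b n powr p * k n)" using summ[of 1] k0 by simp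
  have sZ: "summable (\<lambda>n. b n powr p * k n powr p)" using p by (intro summ) simp
  have swcp: "summable (\<lambda>n. w n * c n powr p)"
    by (rule summable_comparison_test'[OF sZ]) (use wcp_le w0 in simp)
  define Z where "Z = (\<Sum>n. b n powr p * k n powr p)"
  have Z0: "0 \<le> Z" unfolding Z_def using sZ by (intro suminf_nonneg) auto
  note first = weighted_power_mean_suminf[OF p w0 c0 sw swcp]
  show "summable ?T" unfolding wc by (rule first(1))
  have T0: "0 \<le> (\<Sum>n. w n * c n)" using first(1) w0 c0 by (intro suminf_nonneg) auto
  have "(\<Sum>n. w n * c n) powr p \<le> (\<Sum>n. w n) powr (p - 1) * (\<Sum>n. w n * c n powr p)"
    by (rule first(2))
  also have "\<dots> \<le> V powr (p - 1) * Z"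
  proof (rule mult_mono)
    show "(\<Sum>n. w n) powr (p - 1) \<le> V powr (p - 1)"
      using wV sw w0 p by (intro powr_mono2 suminf_nonneg) auto
    show "(\<Sum>n. w n * c n powr p) \<le> Z"
      unfolding Z_def by (rule suminf_le[OF wcp_le swcp sZ])
    show "0 \<le> (\<Sum>n. w n * c n powr p)"
      by (rule suminf_nonneg[OF swcp]) (use w0 in simp)
  qed simp
  finally have "((\<Sum>n. w n * c n) powr p) powr (q / p) \<le> (V powr (p - 1) * Z) powr (q / p)"
    using p pq by (intro powr_mono2) auto
  then have T1: "(\<Sum>n. w n * c n) powr q \<le> V powr ((p - 1) * q / p) * Z powr (q / p)"
    using p T0 Z0 by (simp add: powr_powr powr_mult)
  have sY: "summable (\<lambda>n. b n powr p * (k n powr p) powr (q / p))"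
    using p pq summ[of q] by (simp add: powr_powr)
  have "Z powr (q / p)
      \<le> (\<Sum>n. b n powr p) powr (q / p - 1) * (\<Sum>n. b n powr p * (k n powr p) powr (q / p))"
    unfolding Z_def by (rule weighted_power_mean_suminf(2)[OF _ _ _ sb sY]) (use p pq in auto)
  also have "\<dots> \<le> (\<Sum>n. b n powr p) powr (q / p - 1) * (\<Sum>n. b n powr p * k n)"
  proof (rule mult_left_mono[OF suminf_le[OF _ sY]])
    show "b n powr p * (k n powr p) powr (q / p) \<le> b n powr p * k n" for n
    proof (rule mult_left_mono)
      have "k n powr q \<le> k n powr 1" using k0 k1 p pq by (intro powr_mono') auto
      then show "(k n powr p) powr (q / p) \<le> k n" using p k0 by (simp add: powr_powr)
    qed simp
    show "summable (\<lambda>n. b n powr p * k n)" using summ[of 1] k0 by simp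
  qed simp
  finally have "V powr ((p - 1) * q / p) * Z powr (q / p)
     \<le> V powr ((p - 1) * q / p)
       * ((\<Sum>n. b n powr p) powr (q / p - 1) * (\<Sum>n. b n powr p * k n))"
    by (rule mult_left_mono) simp
  with T1 have "(\<Sum>n. w n * c n) powr q \<le> V powr ((p - 1) * q / p)
      * ((\<Sum>n. b n powr p) powr (q / p - 1) * (\<Sum>n. b n powr p * k n))"
    by (rule order_trans)
  then show "(\<Sum>n. ?T n) powr q
      \<le> V powr ((p - 1) * q / p) * (\<Sum>n. b n powr p) powr (q / p - 1) * (\<Sum>n. b n powr p * k n)"
    unfolding wc by (simp only: mult.assoc)
qed

lemma H_op_measurable: "H_op lam \<alpha> \<beta> a \<in> borel_measurable (lebesgue_on {0<..})"
proof -
  have "H_op lam \<alpha> \<beta> a \<in> borel_measurable borel"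
    unfolding H_op_def[abs_def] H_term_def[abs_def] by measurable
  then show ?thesis
    by (intro measurable_restrict_space1 measurable_completion) simp
qed

text \<open>
  If \<open>lam\<close> exceeds the critical value, then \<open>\<alpha>\<close> may be raised until equality holds: the base \<open>m\<close> is
  at least 1, and the two strict inequalities do not involve \<open>\<alpha>\<close>. In the critical case the weighted
  kernel is homogeneous of the right degree, and its remaining exponents are \<open>2s\<close> and \<open>2t\<close>.
\<close>

lemma H_term_le_hardy_kernel:
  fixes lam \<alpha> \<beta> p \<phi> q \<psi> x :: real
  defines "s \<equiv> (lam - \<beta> - (\<psi> + 1) / q) / 2" and "t \<equiv> (\<beta> + (\<psi> + 1) / q) / 2"
  assumes lam: "\<alpha> + \<beta> + 1 + (\<psi> + 1) / q - (\<phi> + 1) / p \<le> lam"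
  shows "\<bar>H_term lam \<alpha> \<beta> a x (Suc n)\<bar> \<le> x powr (- (\<psi> + 1) / q)
      * (hardy_kernel s t (real (Suc n)) x * hardy_kernel s t (real (Suc n)) x
         * real (Suc n) powr (1 / p - 1) * (real (Suc n) powr (\<phi> / p) * \<bar>a (Suc n)\<bar>))"
proof -
  let ?m = "real (Suc n)"
  have exps: "\<alpha> \<le> 2 * s + (1 / p - 1) + \<phi> / p" "\<beta> = 2 * t + - (\<psi> + 1) / q" "lam = 2 * s + 2 * t"
    using lam by (auto simp: s_def t_def add_divide_distrib diff_divide_distrib)
  have "\<bar>H_term lam \<alpha> \<beta> a x (Suc n)\<bar> = ?m powr \<alpha> * (x powr \<beta> / max ?m x powr lam * \<bar>a (Suc n)\<bar>)"
    by (simp add: H_term_def abs_mult)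
  also have "\<dots> \<le> ?m powr (2 * s + (1 / p - 1) + \<phi> / p)
      * (x powr \<beta> / max ?m x powr lam * \<bar>a (Suc n)\<bar>)"
    using exps by (intro mult_right_mono powr_mono) auto
  also have "\<dots> = x powr (- (\<psi> + 1) / q) * (hardy_kernel (2 * s) (2 * t) ?m x
         * ?m powr (1 / p - 1) * (?m powr (\<phi> / p) * \<bar>a (Suc n)\<bar>))"
    unfolding hardy_kernel_def exps(3)
    by (subst exps(2)) (simp only: powr_add times_divide_eq_left times_divide_eq_right mult_ac)
  finally show ?thesis by (simp only: hardy_kernel_square)
qed

text \<open>
  After multiplication by the weight, the pointwise estimate bounds the \<open>q\<close>-th power of the image by
  a series of kernels against \<open>dx/x\<close>, all of which have the same integral \<open>J\<close>. Integrating term by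
  term leaves the series of \<open>b\<^sup>p\<close>, which is the \<open>p\<close>-th power of the norm of the sequence.
\<close>

lemma conditions_imp_H_bounded:
  assumes p: "1 \<le> p" and pq: "p \<le> q"
    and lam: "\<alpha> + \<beta> + 1 + (\<psi> + 1) / q - (\<phi> + 1) / p \<le> lam"
    and lo: "- q * \<beta> < \<psi> + 1" and hi: "\<psi> + 1 < q * (lam - \<beta>)"
  shows "H_bounded lam \<alpha> \<beta> p \<phi> q \<psi>"
proof -
  have q: "0 < q" using p pq by simp
  define s t where "s = (lam - \<beta> - (\<psi> + 1) / q) / 2" and "t = (\<beta> + (\<psi> + 1) / q) / 2"
  have s: "0 < s" and t: "0 < t" using lo hi q by (auto simp: s_def t_def field_simps)
  define k where "k = (\<lambda>x n. hardy_kernel s t (real (Suc n)) x)"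
  define V where "V = 2 powr (s + t + 1) * (1 / s + 1 / t)"
  define J where "J = 1 / s + 1 / t"
  have J0: "0 < J" using s t by (simp add: J_def add_pos_pos)
  let ?C = "(V powr ((p - 1) * q / p) * J) powr (1 / q)"
  have main: "(\<forall>x>0. summable (\<lambda>n. H_term lam \<alpha> \<beta> a x (Suc n))) \<and>
      H_op lam \<alpha> \<beta> a \<in> fun_space q \<psi> \<and>
      fun_norm q \<psi> (H_op lam \<alpha> \<beta> a) \<le> ?C * seq_norm p \<phi> a" if a: "a \<in> seq_space p \<phi>" for a
  proof -
    define b where "b = (\<lambda>n. real (Suc n) powr (\<phi> / p) * \<bar>a (Suc n)\<bar>)"
    have b0: "0 \<le> b n" for n by (simp add: b_def)
    have bp: "b n powr p = real (Suc n) powr \<phi> * \<bar>a (Suc n)\<bar> powr p" for n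
      using p by (simp add: b_def powr_mult powr_powr)
    have sb: "summable (\<lambda>n. b n powr p)" using a by (simp add: seq_space_def bp)
    define S where "S = (\<Sum>n. b n powr p)"
    have S0: "0 \<le> S" unfolding S_def using sb by (intro suminf_nonneg) auto
    have norm_a: "seq_norm p \<phi> a = S powr (1 / p)" by (simp add: seq_norm_def S_def bp)
    define T where "T = (\<lambda>x n. k x n * k x n * real (Suc n) powr (1 / p - 1) * b n)"
    note mean = hardy_kernel_power_mean[OF p pq s t _ b0 sb, folded k_def T_def V_def S_def]
    have term_le: "\<bar>H_term lam \<alpha> \<beta> a x (Suc n)\<bar> \<le> x powr (- (\<psi> + 1) / q) * T x n" for x n
      using H_term_le_hardy_kernel[OF lam, of a x n]
      unfolding T_def k_def b_def s_def t_def .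
    have sT: "summable (T x)" if "0 < x" for x
      using mean(1)[OF that] by (simp add: T_def k_def)
    have abs_summ: "summable (\<lambda>n. \<bar>H_term lam \<alpha> \<beta> a x (Suc n)\<bar>)" if "0 < x" for x
      by (rule summable_comparison_test'[OF summable_mult[OF sT[OF that]]]) (use term_le in simp)
    have summ: "summable (\<lambda>n. H_term lam \<alpha> \<beta> a x (Suc n))" if "0 < x" for x
      using abs_summ[OF that] by (rule summable_rabs_cancel)
    have H_le: "\<bar>H_op lam \<alpha> \<beta> a x\<bar> \<le> x powr (- (\<psi> + 1) / q) * (\<Sum>n. T x n)" if "0 < x" for x
    proof -
      have "\<bar>H_op lam \<alpha> \<beta> a x\<bar> \<le> (\<Sum>n. \<bar>H_term lam \<alpha> \<beta> a x (Suc n)\<bar>)"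
        unfolding H_op_def by (rule summable_rabs[OF abs_summ[OF that]])
      also have "\<dots> \<le> (\<Sum>n. x powr (- (\<psi> + 1) / q) * T x n)"
        by (rule suminf_le[OF term_le abs_summ[OF that] summable_mult[OF sT[OF that]]])
      also have "\<dots> = x powr (- (\<psi> + 1) / q) * (\<Sum>n. T x n)"
        by (rule suminf_mult[OF sT[OF that]])
      finally show ?thesis .
    qed
    define D where "D = V powr ((p - 1) * q / p) * S powr (q / p - 1)"
    have D0: "0 \<le> D" by (simp add: D_def)
    define g where "g = (\<lambda>n x. b n powr p * (hardy_kernel s t (real (Suc n)) x / x))"
    define G where "G = (\<lambda>x. \<Sum>n. g n x)"
    have g0: "0 \<le> g n x" if "0 < x" for n x using that by (simp add: g_def hardy_kernel_nonneg)
    have gk: "g n x = b n powr p * k x n / x" for n x by (simp add: g_def k_def)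
    have sg: "summable (\<lambda>n. g n x)" and Gk: "G x = (\<Sum>n. b n powr p * k x n) / x" if "0 < x" for x
      using mean(3)[OF that] by (auto simp: gk G_def k_def suminf_divide summable_divide)
    let ?F = "\<lambda>x. \<bar>H_op lam \<alpha> \<beta> a x\<bar> powr q * x powr \<psi>"
    have F_le: "?F x \<le> D * G x" if x: "0 < x" for x
    proof -
      have T0: "0 \<le> (\<Sum>n. T x n)"
        using sT[OF x] b0 by (intro suminf_nonneg) (auto simp: T_def)
      have "?F x \<le> (x powr (- (\<psi> + 1) / q) * (\<Sum>n. T x n)) powr q * x powr \<psi>"
        using H_le[OF x] q by (intro mult_right_mono powr_mono2) auto
      also have "\<dots> = (\<Sum>n. T x n) powr q / x"
      proof -
        have "(x powr (- (\<psi> + 1) / q)) powr q * x powr \<psi> = x powr (-1)"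
          using q by (simp add: powr_powr powr_add[symmetric])
        then show ?thesis using x T0 by (simp add: powr_mult powr_minus_divide field_simps)
      qed
      also have "\<dots> \<le> (D * (\<Sum>n. b n powr p * k x n)) / x"
        using mean(2)[OF x] x unfolding D_def T_def k_def by (intro divide_right_mono) auto
      also have "\<dots> = D * G x" by (simp add: Gk[OF x])
      finally show ?thesis .
    qed
    let ?M = "lebesgue_on {0<..} :: real measure"
    have ae: "AE x in ?M. P x" if "\<And>x. 0 < x \<Longrightarrow> P x" for P
      by (rule AE_I2) (use that in \<open>simp add: space_restrict_space\<close>)
    have int_g: "integrable ?M (g n)" and I_g: "(LINT x|?M. g n x) = b n powr p * J" for n
      using integrable_hardy_kernel[OF s t, of "real (Suc n)"]
        integral_hardy_kernel[OF s t, of "real (Suc n)"]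
      unfolding g_def J_def by (simp_all only: integrable_mult_right integral_mult_right_zero)
    have norm_g: "(LINT x|?M. norm (g n x)) = b n powr p * J" for n
      unfolding I_g[symmetric] by (intro integral_cong_AE ae) (use int_g g0 in auto)
    have ae_g: "AE x in ?M. summable (\<lambda>n. norm (g n x))"
      by (rule ae) (use sg g0 in simp)
    have s_int: "summable (\<lambda>n. LINT x|?M. norm (g n x))"
      unfolding norm_g by (rule summable_mult2[OF sb])
    have int_G: "integrable ?M G"
      unfolding G_def by (rule integrable_suminf[OF int_g ae_g s_int])
    have I_G: "(LINT x|?M. G x) = S * J"
      unfolding G_def integral_suminf[OF int_g ae_g s_int] I_g S_def by (rule suminf_mult2[OF sb, symmetric])
    have meas: "?F \<in> borel_measurable ?M"
    proof -
      have [measurable]: "H_op lam \<alpha> \<beta> a \<in> borel_measurable ?M" by (rule H_op_measurable)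
      have [measurable]: "(\<lambda>x. x) \<in> borel_measurable ?M"
        by (intro measurable_restrict_space1 measurable_completion) simp
      show ?thesis by measurable
    qed
    have int_DG: "integrable ?M (\<lambda>x. D * G x)" using int_G by simp
    have int_F: "integrable ?M ?F"
    proof (rule Bochner_Integration.integrable_bound[OF int_DG meas], rule ae)
      fix x :: real assume "0 < x"
      then show "norm (?F x) \<le> norm (D * G x)" using F_le[of x] by simp
    qed
    have "(LINT x|?M. ?F x) \<le> (LINT x|?M. D * G x)"
      by (intro integral_mono_AE int_F int_DG ae F_le)
    also have "\<dots> = V powr ((p - 1) * q / p) * J * S powr (q / p)"
    proof -
      have "S powr (q / p - 1) * S = S powr (q / p)"
        using S0 by (cases "S = 0") (auto simp: powr_diff)
      then show ?thesis by (simp add: I_G D_def mult_ac)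
    qed
    finally have "fun_norm q \<psi> (H_op lam \<alpha> \<beta> a)
        \<le> (V powr ((p - 1) * q / p) * J * S powr (q / p)) powr (1 / q)"
      unfolding fun_norm_def using q by (intro powr_mono2 integral_nonneg_AE ae) auto
    also have "\<dots> = ?C * seq_norm p \<phi> a"
      using q J0 S0 by (simp add: norm_a powr_mult powr_powr)
    finally show ?thesis using summ int_F H_op_measurable by (auto simp: fun_space_def)
  qed
  show ?thesis
    unfolding H_bounded_def
  proof (intro conjI ballI exI[of _ ?C])
    fix a assume a: "a \<in> seq_space p \<phi>"
    show "AE x in lebesgue_on {0<..}. summable (\<lambda>n. H_term lam \<alpha> \<beta> a x (Suc n))"
      by (rule AE_I2) (use main[OF a] in \<open>simp add: space_restrict_space\<close>)
  qed (use main in auto)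
qed

theorem theorem1p3:
  fixes p q lam \<alpha> \<beta> \<phi> \<psi> :: real
  assumes "1 \<le> p" and "p \<le> q"
  shows "H_bounded lam \<alpha> \<beta> p \<phi> q \<psi> \<longleftrightarrow>
    lam \<ge> \<alpha> + \<beta> + 1 + (\<psi> + 1) / q - (\<phi> + 1) / p \<and>
    - q * \<beta> < \<psi> + 1 \<and> \<psi> + 1 < q * (lam - \<beta>)"
proof
  assume H: "H_bounded lam \<alpha> \<beta> p \<phi> q \<psi>"
  have "0 < p" "0 < q" using assms by auto
  then show "lam \<ge> \<alpha> + \<beta> + 1 + (\<psi> + 1) / q - (\<phi> + 1) / p \<and>
      - q * \<beta> < \<psi> + 1 \<and> \<psi> + 1 < q * (lam - \<beta>)"
    using H_bounded_imp_scaling_condition[OF _ _ H] H_bounded_imp_endpoint_conditions[OF _ H] by simp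
next
  assume "lam \<ge> \<alpha> + \<beta> + 1 + (\<psi> + 1) / q - (\<phi> + 1) / p \<and>
      - q * \<beta> < \<psi> + 1 \<and> \<psi> + 1 < q * (lam - \<beta>)"
  then show "H_bounded lam \<alpha> \<beta> p \<phi> q \<psi>"
    using conditions_imp_H_bounded[OF assms] by simp
qed

end
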